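(* Let $n\geq 3$ be an integer (even or odd), $k\geq 3$ and $m\geq 2$ integers. Then the minimum size of a strong resolving set of vertices of $(C_n\Box P_k)\Box P_m$ is $2n$, i.e. $sdim((C_n\Box P_k)\Box P_m)=2n$.
   Context: $C_n$ denotes the cycle on $n$ vertices and $P_k$, $P_m$ the paths on $k$ and $m$ vertices. For graphs $G,H$, the Cartesian product $G\Box H$ has vertex set $V(G)\times V(H)$, with $(g_1,h_1)$ adjacent to $(g_2,h_2)$ iff either $h_1=h_2$ and $g_1g_2\in E(G)$, or $g_1=g_2$ and $h_1h_2\in E(H)$. In a connected graph $G$, a set $Q\subseteq V(G)$ is a strong resolving set if for any two distinct vertices $p,q$ there is $r\in Q$ such that $p$ lies on a shortest $q$–$r$ path or $q$ lies on a shortest $p$–$r$ path. $sdim(G)$ is the minimum size of a strong resolving set of $G$. *)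

theory Defs
  imports "Graph_Theory.Graph_Theory"
begin

(* An undirected graph is a symmetric pair digraph: the edge uv is the pair of arcs (u,v), (v,u). *)

definition path_graph :: "nat \<Rightarrow> nat pair_pre_digraph" where
  "path_graph k = \<lparr> pverts = {..<k},
     parcs = {(i, j). i < k \<and> j < k \<and> (j = Suc i \<or> i = Suc j)} \<rparr>"

(* Intended for n \<ge> 3; for smaller n this is not a cycle (n = 1 even has a loop). *)
definition cycle_graph :: "nat \<Rightarrow> nat pair_pre_digraph" where
  "cycle_graph n = \<lparr> pverts = {..<n},
     parcs = {(i, j). i < n \<and> j < n \<and> (j = Suc i mod n \<or> i = Suc j mod n)} \<rparr>"

definition cartesian_product ::
  "'a pair_pre_digraph \<Rightarrow> 'b pair_pre_digraph \<Rightarrow> ('a \<times> 'b) pair_pre_digraph"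
  (infixl \<open>\<box>\<close> 70) where
  "G \<box> H = \<lparr> pverts = pverts G \<times> pverts H,
     parcs = {((g1, h1), (g2, h2)).
       g1 \<in> pverts G \<and> g2 \<in> pverts G \<and> h1 \<in> pverts H \<and> h2 \<in> pverts H \<and>
       (h1 = h2 \<and> (g1, g2) \<in> parcs G \<or> g1 = g2 \<and> (h1, h2) \<in> parcs H)} \<rparr>"

definition shortest_path :: "'a pair_pre_digraph \<Rightarrow> 'a \<Rightarrow> ('a \<times> 'a) awalk \<Rightarrow> 'a \<Rightarrow> bool" where
  "shortest_path G u P v \<longleftrightarrow> pre_digraph.apath (with_proj G) u P v \<and>
     (\<forall>P'. pre_digraph.apath (with_proj G) u P' v \<longrightarrow> length P \<le> length P')"

definition on_shortest_path :: "'a pair_pre_digraph \<Rightarrow> 'a \<Rightarrow> 'a \<Rightarrow> 'a \<Rightarrow> bool" where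
  "on_shortest_path G x u v \<longleftrightarrow>
     (\<exists>P. shortest_path G u P v \<and> x \<in> set (pre_digraph.awalk_verts (with_proj G) u P))"

definition strong_resolving_set :: "'a pair_pre_digraph \<Rightarrow> 'a set \<Rightarrow> bool" where
  "strong_resolving_set G Q \<longleftrightarrow> Q \<subseteq> pverts G \<and>
     (\<forall>p\<in>pverts G. \<forall>q\<in>pverts G. p \<noteq> q \<longrightarrow>
        (\<exists>r\<in>Q. on_shortest_path G p q r \<or> on_shortest_path G q p r))"

definition sdim :: "'a pair_pre_digraph \<Rightarrow> nat" where
  "sdim G = (LEAST s. \<exists>Q. finite Q \<and> strong_resolving_set G Q \<and> card Q = s)"

lemma pair_graphI:
  assumes "finite (pverts G)" "parcs G \<subseteq> pverts G \<times> pverts G" "sym (parcs G)"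
    "\<And>u. (u, u) \<notin> parcs G"
  shows "pair_graph G"
proof -
  have "finite (parcs G)"
    using assms(1,2) by (meson finite_SigmaI finite_subset)
  with assms show ?thesis
    by unfold_locales (auto simp: symmetric_def)
qed

lemma pair_graph_path_graph: "pair_graph (path_graph k)"
  by (rule pair_graphI) (auto simp: path_graph_def sym_def)

lemma pair_graph_cycle_graph:
  assumes "n \<ge> 3"
  shows "pair_graph (cycle_graph n)"
proof -
  have "i \<noteq> Suc i mod n" if "i < n" for i
    using assms that by (cases "Suc i = n") auto
  then show ?thesis
    by (intro pair_graphI) (auto simp: cycle_graph_def sym_def)
qed

lemma pair_graph_cartesian_product:
  assumes "pair_graph G" "pair_graph H"
  shows "pair_graph (G \<box> H)"
proof -
  interpret G: pair_graph G by fact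
  interpret H: pair_graph H by fact
  show ?thesis
    by (rule pair_graphI)
      (auto simp: cartesian_product_def sym_def G.pair_finite_verts H.pair_finite_verts
        dest: G.arcs_symmetric H.arcs_symmetric G.no_loops' H.no_loops')
qed

lemma mk_symmetric_pair_graph:
  assumes "pair_graph G"
  shows "mk_symmetric (with_proj G) = G"
proof -
  interpret G: pair_graph G by fact
  have "(\<Union>e\<in>parcs G. {(fst e, snd e), (snd e, fst e)}) = parcs G"
    by (auto dest: G.arcs_symmetric)
  then show ?thesis
    by (simp add: mk_symmetric_def)
qed

lemma connected_pair_graphI:
  assumes "pair_graph G" "u \<in> pverts G" "\<And>v. v \<in> pverts G \<Longrightarrow> u \<rightarrow>\<^sup>*\<^bsub>with_proj G\<^esub> v"
  shows "connected (with_proj G)"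
proof -
  interpret G: pair_graph G by fact
  have "strongly_connected (with_proj G)"
  proof (rule strongly_connectedI)
    show "verts (with_proj G) \<noteq> {}" using assms(2) by auto
    fix v w assume "v \<in> verts (with_proj G)" "w \<in> verts (with_proj G)"
    then have "u \<rightarrow>\<^sup>*\<^bsub>with_proj G\<^esub> v" "u \<rightarrow>\<^sup>*\<^bsub>with_proj G\<^esub> w"
      using assms(3) by simp_all
    then show "v \<rightarrow>\<^sup>*\<^bsub>with_proj G\<^esub> w"
      by (meson G.reachable_trans G.symmetric_reachable')
  qed
  then show ?thesis
    by (simp add: connected_def mk_symmetric_pair_graph assms(1))
qed

lemma connected_path_graph:
  assumes "k > 0"
  shows "connected (with_proj (path_graph k))"
proof (rule connected_pair_graphI[OF pair_graph_path_graph, of 0])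
  interpret pair_graph "path_graph k" by (rule pair_graph_path_graph)
  show "0 \<in> pverts (path_graph k)"
    using assms by (simp add: path_graph_def)
  show "0 \<rightarrow>\<^sup>*\<^bsub>with_proj (path_graph k)\<^esub> v" if "v \<in> pverts (path_graph k)" for v
    using that
  proof (induction v)
    case 0
    then show ?case by auto
  next
    case (Suc v)
    then have "0 \<rightarrow>\<^sup>*\<^bsub>with_proj (path_graph k)\<^esub> v" "(v, Suc v) \<in> parcs (path_graph k)"
      by (auto simp: path_graph_def)
    then show ?case
      by (metis reachable_adj_trans with_proj_simps(3))
  qed
qed

lemma connected_cycle_graph:
  assumes "n \<ge> 3"
  shows "connected (with_proj (cycle_graph n))"
proof (rule connected_pair_graphI[OF pair_graph_cycle_graph[OF assms], of 0])
  interpret pair_graph "cycle_graph n" using assms by (rule pair_graph_cycle_graph)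
  show "0 \<in> pverts (cycle_graph n)"
    using assms by (simp add: cycle_graph_def)
  show "0 \<rightarrow>\<^sup>*\<^bsub>with_proj (cycle_graph n)\<^esub> v" if "v \<in> pverts (cycle_graph n)" for v
    using that
  proof (induction v)
    case 0
    then show ?case by auto
  next
    case (Suc v)
    then have "0 \<rightarrow>\<^sup>*\<^bsub>with_proj (cycle_graph n)\<^esub> v" "(v, Suc v) \<in> parcs (cycle_graph n)"
      by (auto simp: cycle_graph_def)
    then show ?case
      by (metis reachable_adj_trans with_proj_simps(3))
  qed
qed

lemma connected_cartesian_product:
  assumes "pair_graph G" "connected (with_proj G)" "pair_graph H" "connected (with_proj H)"
  shows "connected (with_proj (G \<box> H))"
proof -
  interpret G: pair_graph G by fact
  interpret H: pair_graph H by fact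
  have pg: "pair_graph (G \<box> H)"
    using assms by (intro pair_graph_cartesian_product)
  interpret GH: pair_graph "G \<box> H" by (rule pg)
  have sc: "strongly_connected (with_proj G)" "strongly_connected (with_proj H)"
    using assms by (simp_all add: connected_def mk_symmetric_pair_graph)
  then obtain g h where gh: "g \<in> pverts G" "h \<in> pverts H"
    by (auto simp: strongly_connected_def)
  have left: "(g, h) \<rightarrow>\<^sup>*\<^bsub>with_proj (G \<box> H)\<^esub> (x, h)" if "g \<rightarrow>\<^sup>*\<^bsub>with_proj G\<^esub> x" for x
    using that
  proof (induction rule: G.reachable_induct)
    case base
    show ?case
      by (rule GH.reachable_refl) (use base gh in \<open>simp add: cartesian_product_def\<close>)
  next
    case (step x y)
    then have "((x, h), (y, h)) \<in> parcs (G \<box> H)"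
      using gh by (auto simp: cartesian_product_def dest: G.in_arcsD1 G.in_arcsD2)
    with step show ?case by (metis GH.reachable_adj_trans with_proj_simps(3))
  qed
  have right: "(x, h) \<rightarrow>\<^sup>*\<^bsub>with_proj (G \<box> H)\<^esub> (x, y)"
    if "h \<rightarrow>\<^sup>*\<^bsub>with_proj H\<^esub> y" "x \<in> pverts G" for x y
    using that
  proof (induction rule: H.reachable_induct)
    case base
    show ?case
      by (rule GH.reachable_refl) (use base gh in \<open>simp add: cartesian_product_def\<close>)
  next
    case (step y z)
    then have "((x, y), (x, z)) \<in> parcs (G \<box> H)"
      by (auto simp: cartesian_product_def dest: H.in_arcsD1 H.in_arcsD2)
    with step show ?case by (metis GH.reachable_adj_trans with_proj_simps(3))
  qed
  show ?thesis
  proof (rule connected_pair_graphI[OF pg, of "(g, h)"])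
    show "(g, h) \<in> pverts (G \<box> H)"
      using gh by (simp add: cartesian_product_def)
    fix v assume "v \<in> pverts (G \<box> H)"
    then obtain x y where v: "v = (x, y)" "x \<in> pverts G" "y \<in> pverts H"
      by (auto simp: cartesian_product_def)
    then have "g \<rightarrow>\<^sup>*\<^bsub>with_proj G\<^esub> x" "h \<rightarrow>\<^sup>*\<^bsub>with_proj H\<^esub> y"
      using sc gh by (auto simp: strongly_connected_def)
    then show "(g, h) \<rightarrow>\<^sup>*\<^bsub>with_proj (G \<box> H)\<^esub> v"
      unfolding v(1) using left right v(2) GH.reachable_trans by blast
  qed
qed

end

theory Submission
  imports Defs "HOL-Number_Theory.Cong"
begin

text \<open>Distances in a Cartesian product are sums of the distances in the factors. If p and q are at
  distance equal to the diameter, then p lies on a shortest path from q to r only for r = p, so every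
  strong resolving set contains p or q. Pairing each vertex (i, 0, c), where c is an end of the last
  path, with the vertex opposite to it in all three coordinates gives 2n disjoint pairs of this kind.
  Conversely the 2n vertices (i, 0, c) suffice: if the second coordinate of p is at most that of q,
  then continuing from q to p and on inside the two paths leads to (i, 0, c), where i is the first
  coordinate of p and c is the end of the last path on the side of p.\<close>

section \<open>Distance functions and shortest paths\<close>

text \<open>A local description of the shortest-path distance: d changes by at most 1 along an arc, so it is a
  lower bound for lengths of walks, and it can always be lowered by 1, so the bound is attained.\<close>

definition graph_dist :: "'a pair_pre_digraph \<Rightarrow> ('a \<Rightarrow> 'a \<Rightarrow> nat) \<Rightarrow> bool" where
  "graph_dist G d \<longleftrightarrow>
     (\<forall>u\<in>pverts G. \<forall>v\<in>pverts G. d u v = 0 \<longleftrightarrow> u = v) \<and>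
     (\<forall>(u, u')\<in>parcs G. \<forall>v\<in>pverts G. d u v \<le> d u' v + 1) \<and>
     (\<forall>u\<in>pverts G. \<forall>v\<in>pverts G. u \<noteq> v \<longrightarrow> (\<exists>u'. (u, u') \<in> parcs G \<and> d u v = d u' v + 1))"

lemma graph_distI:
  assumes "\<And>u v. \<lbrakk>u \<in> pverts G; v \<in> pverts G\<rbrakk> \<Longrightarrow> d u v = 0 \<longleftrightarrow> u = v"
    and "\<And>u u' v. \<lbrakk>(u, u') \<in> parcs G; v \<in> pverts G\<rbrakk> \<Longrightarrow> d u v \<le> d u' v + 1"
    and "\<And>u v. \<lbrakk>u \<in> pverts G; v \<in> pverts G; u \<noteq> v\<rbrakk> \<Longrightarrow>
      \<exists>u'. (u, u') \<in> parcs G \<and> d u v = d u' v + 1"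
  shows "graph_dist G d"
  using assms by (auto simp: graph_dist_def)

lemma graph_dist_eq_0:
  "\<lbrakk>graph_dist G d; u \<in> pverts G; v \<in> pverts G\<rbrakk> \<Longrightarrow> d u v = 0 \<longleftrightarrow> u = v"
  by (simp add: graph_dist_def)

lemma graph_dist_arc:
  "\<lbrakk>graph_dist G d; (u, u') \<in> parcs G; v \<in> pverts G\<rbrakk> \<Longrightarrow> d u v \<le> d u' v + 1"
  unfolding graph_dist_def by blast

lemma graph_dist_step:
  assumes "graph_dist G d" "u \<in> pverts G" "v \<in> pverts G" "u \<noteq> v"
  obtains u' where "(u, u') \<in> parcs G" "d u v = d u' v + 1"
  using assms unfolding graph_dist_def by blast

lemma graph_dist_le_length_awalk:
  assumes "pair_graph G" "graph_dist G d" "pre_digraph.awalk (with_proj G) u P v"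
  shows "d u v \<le> length P"
proof -
  interpret pair_graph G by fact
  show ?thesis
    using assms(3)
  proof (induction P arbitrary: u)
    case Nil
    then have "u = v" "v \<in> pverts G"
      by (auto simp: awalk_Nil_iff)
    then show ?case
      using graph_dist_eq_0[OF assms(2), of v v] by simp
  next
    case (Cons e es)
    then have e: "(u, snd e) \<in> parcs G" and es: "awalk (snd e) es v"
      by (simp_all add: awalk_Cons_iff)
    have "v \<in> pverts G"
      using awalk_last_in_verts[OF es] by simp
    from graph_dist_arc[OF assms(2) e this] Cons.IH[OF es] show ?case
      by simp
  qed
qed

lemma graph_dist_awalk:
  assumes "pair_graph G" "graph_dist G d" "u \<in> pverts G" "v \<in> pverts G"
  obtains P where "pre_digraph.awalk (with_proj G) u P v" "length P = d u v"
proof -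
  interpret pair_graph G by fact
  have "\<exists>P. awalk u P v \<and> length P = d u v"
    using assms(3)
  proof (induction "d u v" arbitrary: u)
    case 0
    then have "u = v"
      using graph_dist_eq_0[OF assms(2) 0(2) assms(4)] by simp
    then show ?case
      using 0 by (intro exI[of _ "[]"]) (simp add: awalk_Nil_iff)
  next
    case (Suc l)
    then have "u \<noteq> v"
      using graph_dist_eq_0[OF assms(2) Suc.prems assms(4)] by simp
    then obtain u' where u': "(u, u') \<in> parcs G" "d u v = d u' v + 1"
      by (rule graph_dist_step[OF assms(2) Suc.prems assms(4)])
    have "l = d u' v"
      using u'(2) Suc.hyps(2) by simp
    from Suc.hyps(1)[OF this in_arcsD2[OF u'(1)]]
    obtain P where "awalk u' P v" "length P = d u' v"
      by blast
    then show ?case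
      using u' by (intro exI[of _ "(u, u') # P"]) (simp add: awalk_Cons_iff)
  qed
  then show ?thesis using that by blast
qed

text \<open>\<open>shortest_path\<close> minimises over paths without repeated vertices, whereas
  \<open>graph_dist\<close> controls walks. The two agree because a walk of length
  \<open>d u v\<close> cannot repeat a vertex: cutting out the closed part would leave a walk
  shorter than the lower bound \<open>d u v\<close>.\<close>

lemma shortest_path_iff:
  assumes "pair_graph G" "graph_dist G d"
  shows "shortest_path G u P v \<longleftrightarrow>
    pre_digraph.awalk (with_proj G) u P v \<and> length P = d u v"
proof -
  interpret pair_graph G by fact
  have apath: "apath u P v" if P: "awalk u P v" "length P = d u v" for P
  proof (rule ccontr)
    assume "\<not> apath u P v"
    then have "\<not> distinct (awalk_verts u P)"
      using P by (simp add: apath_def)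
    then obtain q r s w where "P = q @ r @ s" "0 < length r" "awalk u q w" "awalk w s v"
      using awalk_not_distinct_decomp[OF P(1)] by blast
    moreover from this have "d u v \<le> length (q @ s)"
      by (intro graph_dist_le_length_awalk[OF assms] awalk_appendI)
    ultimately show False using P(2) by (cases r) simp_all
  qed
  have le: "d u v \<le> length P" if "apath u P v" for P
    using graph_dist_le_length_awalk[OF assms, of u P v] that by (simp add: apath_def)
  show ?thesis
  proof
    assume P: "shortest_path G u P v"
    then have awalk: "awalk u P v"
      by (auto simp: shortest_path_def apath_def)
    then have "u \<in> pverts G" "v \<in> pverts G"
      using awalk_hd_in_verts awalk_last_in_verts by fastforce+
    then obtain P' where "awalk u P' v" "length P' = d u v"
      by (rule graph_dist_awalk[OF assms])
    then have "length P \<le> d u v"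
      using P apath[of P'] by (auto simp: shortest_path_def)
    then show "awalk u P v \<and> length P = d u v"
      using awalk graph_dist_le_length_awalk[OF assms awalk] by simp
  next
    assume "awalk u P v \<and> length P = d u v"
    then show "shortest_path G u P v"
      using apath le by (auto simp: shortest_path_def)
  qed
qed

text \<open>Reduces strong resolution to arithmetic. A shortest path splits at \<open>x\<close> into
  walks at least as long as the two distances. Conversely, joining optimal walks through
  \<open>x\<close> gives a walk of length at most, hence exactly, \<open>d u v\<close>. An
  inequality is thus enough to test for equality.\<close>

lemma on_shortest_path_iff:
  assumes "pair_graph G" "graph_dist G d" "u \<in> pverts G" "x \<in> pverts G" "v \<in> pverts G"
  shows "on_shortest_path G x u v \<longleftrightarrow> d u x + d x v \<le> d u v"
proof -
  interpret pair_graph G by fact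
  show ?thesis
  proof
    assume "on_shortest_path G x u v"
    then obtain P where P: "awalk u P v" "length P = d u v" "x \<in> set (awalk_verts u P)"
      using shortest_path_iff[OF assms(1,2)] by (auto simp: on_shortest_path_def)
    obtain q r where "P = q @ r" and q: "awalk u q x" and r: "awalk x r v"
      using awalk_decomp[OF P(1,3)] by blast
    then show "d u x + d x v \<le> d u v"
      using P(2) graph_dist_le_length_awalk[OF assms(1,2) q]
        graph_dist_le_length_awalk[OF assms(1,2) r] by simp
  next
    assume le: "d u x + d x v \<le> d u v"
    obtain q where q: "awalk u q x" "length q = d u x"
      by (rule graph_dist_awalk[OF assms(1-4)])
    obtain r where r: "awalk x r v" "length r = d x v"
      by (rule graph_dist_awalk[OF assms(1,2,4,5)])
    have walk: "awalk u (q @ r) v"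
      using q(1) r(1) by (rule awalk_appendI)
    moreover have "length (q @ r) = d u v"
      using graph_dist_le_length_awalk[OF assms(1,2) walk] le q r by simp
    moreover have "x \<in> set (awalk_verts u (q @ r))"
    proof -
      have "awlast u q = x" using q(1) awlast_if_cas[of u q x] by (simp add: awalk_def)
      then have "x \<in> set (awalk_verts u q)"
        using last_in_set[OF awalk_verts_non_Nil, of u q] by simp
      then show ?thesis
        unfolding awalk_verts_append[OF walk] by simp
    qed
    ultimately show "on_shortest_path G x u v"
      unfolding on_shortest_path_def shortest_path_iff[OF assms(1,2)]
        awalk_verts_with_proj_eq by blast
  qed
qed

section \<open>Distances in paths, cycles and products\<close>

text \<open>Subtraction on \<open>nat\<close> truncates, so one summand is 0 and the sum is the
  absolute difference.\<close>

definition path_dist :: "nat \<Rightarrow> nat \<Rightarrow> nat" where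
  "path_dist i j = (i - j) + (j - i)"

text \<open>The two arcs of the cycle between \<open>i\<close> and \<open>j\<close> have lengths
  \<open>path_dist i j\<close> and \<open>n - path_dist i j\<close>.\<close>

definition cycle_dist :: "nat \<Rightarrow> nat \<Rightarrow> nat \<Rightarrow> nat" where
  "cycle_dist n i j = min (path_dist i j) (n - path_dist i j)"

definition product_dist ::
  "('a \<Rightarrow> 'a \<Rightarrow> nat) \<Rightarrow> ('b \<Rightarrow> 'b \<Rightarrow> nat) \<Rightarrow> 'a \<times> 'b \<Rightarrow> 'a \<times> 'b \<Rightarrow> nat" where
  "product_dist d e u v = d (fst u) (fst v) + e (snd u) (snd v)"

lemma graph_dist_path_graph: "graph_dist (path_graph k) path_dist"
proof (rule graph_distI)
  fix u v assume uv: "u \<in> pverts (path_graph k)" "v \<in> pverts (path_graph k)" "u \<noteq> v"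
  show "\<exists>u'. (u, u') \<in> parcs (path_graph k) \<and> path_dist u v = path_dist u' v + 1"
    using uv by (intro exI[of _ "if u < v then u + 1 else u - 1"])
      (auto simp: path_graph_def path_dist_def)
qed (auto simp: path_graph_def path_dist_def)

lemma graph_dist_cycle_graph: "graph_dist (cycle_graph n) (cycle_dist n)"
proof (rule graph_distI)
  fix u v assume "u \<in> pverts (cycle_graph n)" "v \<in> pverts (cycle_graph n)"
  then show "cycle_dist n u v = 0 \<longleftrightarrow> u = v"
    by (auto simp: cycle_graph_def cycle_dist_def path_dist_def min_def)
next
  fix u u' v assume "(u, u') \<in> parcs (cycle_graph n)" "v \<in> pverts (cycle_graph n)"
  \<comment> \<open>Separating the wrap-around arcs removes \<open>mod\<close> and leaves a linear
    problem.\<close>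
  then have "u < n" "v < n" "u' < n" "u' = Suc u \<or> u = Suc u' \<or>
      Suc u = n \<and> u' = 0 \<or> Suc u' = n \<and> u = 0"
    by (auto simp: cycle_graph_def mod_Suc split: if_splits)
  then show "cycle_dist n u v \<le> cycle_dist n u' v + 1"
    unfolding cycle_dist_def path_dist_def by linarith
next
  fix u v assume "u \<in> pverts (cycle_graph n)" "v \<in> pverts (cycle_graph n)" "u \<noteq> v"
  then have uv: "u < n" "v < n" "u \<noteq> v"
    by (auto simp: cycle_graph_def)
  define up where "up = (if Suc u = n then 0 else Suc u)"
  define down where "down = (if u = 0 then n - 1 else u - 1)"
  have "(u, up) \<in> parcs (cycle_graph n)" "(u, down) \<in> parcs (cycle_graph n)"
    using uv by (auto simp: cycle_graph_def up_def down_def mod_Suc)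
  \<comment> \<open>Going up follows a shorter arc if \<open>v\<close> lies above \<open>u\<close>
    and the direct arc is at most half the cycle, or if \<open>v\<close> lies below \<open>u\<close>
    and the direct arc is longer than that. In the other cases going down does.\<close>
  moreover have "cycle_dist n u v =
    cycle_dist n (if (u < v) = (2 * path_dist u v \<le> n) then up else down) v + 1"
  proof (cases "u < v")
    case True
    then show ?thesis
      using uv
      by (cases "2 * (v - u) \<le> n"; simp add: cycle_dist_def path_dist_def up_def down_def; linarith)
  next
    case False
    then show ?thesis
      using uv
      by (cases "2 * (u - v) \<le> n"; simp add: cycle_dist_def path_dist_def up_def down_def; linarith)
  qed
  ultimately show "\<exists>u'. (u, u') \<in> parcs (cycle_graph n) \<and> cycle_dist n u v = cycle_dist n u' v + 1"
    by metis
qed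

lemma graph_dist_cartesian_product:
  assumes "pair_graph G" "graph_dist G d" "pair_graph H" "graph_dist H e"
  shows "graph_dist (G \<box> H) (product_dist d e)"
proof (rule graph_distI)
  interpret G: pair_graph G by fact
  interpret H: pair_graph H by fact
  {
    fix u v assume "u \<in> pverts (G \<box> H)" "v \<in> pverts (G \<box> H)"
    then show "product_dist d e u v = 0 \<longleftrightarrow> u = v"
      using graph_dist_eq_0[OF assms(2)] graph_dist_eq_0[OF assms(4)]
      by (auto simp: cartesian_product_def product_dist_def)
  next
    fix u u' v assume "(u, u') \<in> parcs (G \<box> H)" "v \<in> pverts (G \<box> H)"
    then show "product_dist d e u v \<le> product_dist d e u' v + 1"
      using graph_dist_arc[OF assms(2)] graph_dist_arc[OF assms(4)]
      by (fastforce simp: cartesian_product_def product_dist_def)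
  next
    fix u v assume "u \<in> pverts (G \<box> H)" "v \<in> pverts (G \<box> H)" "u \<noteq> v"
    then obtain g h g' h' where uv: "u = (g, h)" "v = (g', h')"
      "g \<in> pverts G" "g' \<in> pverts G" "h \<in> pverts H" "h' \<in> pverts H" "g \<noteq> g' \<or> h \<noteq> h'"
      by (auto simp: cartesian_product_def)
    show "\<exists>u'. (u, u') \<in> parcs (G \<box> H) \<and> product_dist d e u v = product_dist d e u' v + 1"
    \<comment> \<open>One move changes one coordinate only: correct the first coordinate while it is
      wrong, then the second.\<close>
    proof (cases "g = g'")
      case False
      then obtain x where "(g, x) \<in> parcs G" "d g g' = d x g' + 1"
        using graph_dist_step[OF assms(2)] uv by metis
      then show ?thesis
        using uv by (intro exI[of _ "(x, h)"])
          (auto simp: cartesian_product_def product_dist_def dest: G.in_arcsD2)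
    next
      case True
      then obtain y where "(h, y) \<in> parcs H" "e h h' = e y h' + 1"
        using graph_dist_step[OF assms(4)] uv by metis
      then show ?thesis
        using uv by (intro exI[of _ "(g, y)"])
          (auto simp: cartesian_product_def product_dist_def dest: H.in_arcsD2)
    qed
  }
qed

section \<open>Tools for the lower bound\<close>

text \<open>It suffices that each of \<open>p\<close> and \<open>q\<close> is farthest from the
  other. If \<open>p\<close> lies on a shortest path from \<open>q\<close> to \<open>r\<close>, then
  \<open>d q p + d p r\<close> is at most \<open>d q r\<close>, hence at most \<open>d q p\<close>,
  which forces \<open>d p r = 0\<close>. The other case is symmetric.\<close>

lemma strong_resolving_set_diametral_pair:
  assumes "pair_graph G" "graph_dist G d" "strong_resolving_set G Q"
    and "p \<in> pverts G" "q \<in> pverts G" "p \<noteq> q"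
    and "\<And>r. r \<in> pverts G \<Longrightarrow> d q r \<le> d q p" "\<And>r. r \<in> pverts G \<Longrightarrow> d p r \<le> d p q"
  shows "p \<in> Q \<or> q \<in> Q"
proof -
  obtain r where r: "r \<in> Q" "r \<in> pverts G" "on_shortest_path G p q r \<or> on_shortest_path G q p r"
    using assms(3-6) unfolding strong_resolving_set_def by blast
  then have "d p r = 0 \<or> d q r = 0"
    using on_shortest_path_iff[OF assms(1,2)] assms(4,5,7,8) by fastforce
  then have "r = p \<or> r = q"
    using graph_dist_eq_0[OF assms(2)] assms(4,5) r(2) by blast
  with r show ?thesis by blast
qed

text \<open>Choosing a point of \<open>Q\<close> in each member is injective, since the members are
  disjoint.\<close>

lemma card_disjoint_family_le:
  assumes "finite Q" "disjoint_family_on A I" "\<And>i. i \<in> I \<Longrightarrow> A i \<inter> Q \<noteq> {}"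
  shows "card I \<le> card Q"
proof -
  from assms(3) have "\<forall>i\<in>I. \<exists>x. x \<in> A i \<inter> Q" by blast
  then obtain f where f: "\<And>i. i \<in> I \<Longrightarrow> f i \<in> A i \<inter> Q" by metis
  then have "inj_on f I"
    using assms(2) by (fastforce simp: inj_on_def disjoint_family_on_def)
  then show ?thesis
    using f assms(1) by (auto intro: card_inj_on_le[of f I Q])
qed

lemma cycle_dist_le: "cycle_dist n i j \<le> n div 2"
  by (auto simp: cycle_dist_def)

lemma cycle_dist_antipode:
  assumes "i < n"
  shows "cycle_dist n i ((i + n div 2) mod n) = n div 2"
    and "cycle_dist n ((i + n div 2) mod n) i = n div 2"
proof -
  \<comment> \<open>Whether \<open>i + n div 2\<close> wraps around decides which of the two arcs is
    the absolute difference; for either parity of \<open>n\<close> the shorter one has length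
    \<open>n div 2\<close>.\<close>
  have "path_dist i ((i + n div 2) mod n) \<in> {n div 2, n - n div 2}"
    using assms by (cases "i + n div 2 < n") (auto simp: path_dist_def mod_if)
  then show "cycle_dist n i ((i + n div 2) mod n) = n div 2"
    by (auto simp: cycle_dist_def)
  then show "cycle_dist n ((i + n div 2) mod n) i = n div 2"
    by (simp add: cycle_dist_def path_dist_def add.commute)
qed

lemma inj_on_add_mod:
  fixes n c :: nat
  shows "inj_on (\<lambda>i. (i + c) mod n) {..<n}"
proof (rule inj_onI)
  fix i j assume *: "i \<in> {..<n}" "j \<in> {..<n}" "(i + c) mod n = (j + c) mod n"
  then have "i mod n = j mod n"
    by (metis cong_add_rcancel_nat cong_def)
  with * show "i = j" by simp
qed

section \<open>Both bounds for the threefold product\<close>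

context
  fixes n k m :: nat
  assumes nkm: "n \<ge> 3" "k \<ge> 2" "m \<ge> 2"
begin

abbreviation "prism \<equiv> (cycle_graph n \<box> path_graph k) \<box> path_graph m"
abbreviation "prism_dist \<equiv> product_dist (product_dist (cycle_dist n) path_dist) path_dist"

lemma pair_graph_prism: "pair_graph prism"
  using nkm by (intro pair_graph_cartesian_product pair_graph_cycle_graph pair_graph_path_graph)

lemma graph_dist_prism: "graph_dist prism prism_dist"
  using nkm by (intro graph_dist_cartesian_product pair_graph_cartesian_product
    pair_graph_cycle_graph pair_graph_path_graph graph_dist_cycle_graph graph_dist_path_graph)

lemma pverts_prism: "pverts prism = ({..<n} \<times> {..<k}) \<times> {..<m}"
  by (simp add: cartesian_product_def cycle_graph_def path_graph_def)

lemma on_shortest_path_prism: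
  assumes "u \<in> pverts prism" "x \<in> pverts prism" "v \<in> pverts prism"
  shows "on_shortest_path prism x u v \<longleftrightarrow> prism_dist u x + prism_dist x v \<le> prism_dist u v"
  using on_shortest_path_iff[OF pair_graph_prism graph_dist_prism] assms by blast

lemma prism_strong_resolving_set:
  "strong_resolving_set prism (({..<n} \<times> {0}) \<times> {0, m - 1})"
  unfolding strong_resolving_set_def
proof (intro conjI ballI impI)
  let ?Q = "({..<n} \<times> {0}) \<times> {0, m - 1}"
  show Q: "?Q \<subseteq> pverts prism"
    using nkm by (auto simp: pverts_prism)
  have *: "\<exists>r\<in>?Q. on_shortest_path prism p q r"
    if "p \<in> pverts prism" "q \<in> pverts prism" "snd (fst p) \<le> snd (fst q)" for p q
  proof -
    obtain a b c where p: "p = ((a, b), c)" by (metis surj_pair)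
    obtain a' b' c' where q: "q = ((a', b'), c')" by (metis surj_pair)
    have bounds: "a < n" "a' < n" "b \<le> b'" "c < m" "c' < m"
      using that by (auto simp: p q pverts_prism)
    define r :: "(nat \<times> nat) \<times> nat" where "r = ((a, 0), if c \<le> c' then 0 else m - 1)"
    have r: "r \<in> ?Q" using bounds by (auto simp: r_def)
    \<comment> \<open>The inequality holds in each coordinate: on the cycle \<open>p\<close> and
      \<open>r\<close> agree, on the first path \<open>b\<close> lies between \<open>b'\<close> and
      0, and on the last path \<open>c\<close> lies between \<open>c'\<close> and the chosen
      end.\<close>
    moreover have "prism_dist q p + prism_dist p r \<le> prism_dist q r"
      using bounds by (auto simp: p q r_def product_dist_def path_dist_def cycle_dist_def)
    ultimately show ?thesis
      using on_shortest_path_prism that(1,2) Q by blast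
  qed
  fix p q assume pq: "p \<in> pverts prism" "q \<in> pverts prism"
  show "\<exists>r\<in>?Q. on_shortest_path prism p q r \<or> on_shortest_path prism q p r"
  proof (cases "snd (fst p) \<le> snd (fst q)")
    case True
    from *[OF pq this] show ?thesis by blast
  next
    case False
    then have "snd (fst q) \<le> snd (fst p)" by simp
    from *[OF pq(2,1) this] show ?thesis by blast
  qed
qed

lemma prism_strong_resolving_set_card_ge:
  assumes "finite Q" "strong_resolving_set prism Q"
  shows "2 * n \<le> card Q"
proof -
  \<comment> \<open>The map sending \<open>c\<close> to \<open>m - 1 - c\<close> exchanges the two
    ends of the last path.\<close>
  define A where "A = (\<lambda>(i, c). {((i, 0), c), (((i + n div 2) mod n, k - 1), m - 1 - c)})"
  let ?I = "{..<n} \<times> {0, m - 1}"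
  have "disjoint_family_on A ?I"
  proof (unfold disjoint_family_on_def, intro ballI impI)
    fix x y assume xy: "x \<in> ?I" "y \<in> ?I" "x \<noteq> y"
    obtain i c where x: "x = (i, c)" by (metis surj_pair)
    obtain j c' where y: "y = (j, c')" by (metis surj_pair)
    have "i = j" if "(i + n div 2) mod n = (j + n div 2) mod n"
      using inj_onD[OF inj_on_add_mod that] xy x y by auto
    moreover have "c = c'" if "m - 1 - c = m - 1 - c'"
      using xy x y that by auto
    \<comment> \<open>The second coordinate tells the two vertices of a pair apart, so different
      pairs could meet only in vertices of the same kind; the two preceding facts exclude
      this.\<close>
    moreover have "k - 1 \<noteq> 0" using nkm by simp
    ultimately show "A x \<inter> A y = {}"
      using xy(3) unfolding A_def x y by auto
  qed
  moreover have "A x \<inter> Q \<noteq> {}" if x: "x \<in> ?I" for x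
  proof -
    obtain i c where ic: "x = (i, c)" "i < n" "c = 0 \<or> c = m - 1" using x by auto
    define p q where "p = ((i, 0::nat), c)" and "q = (((i + n div 2) mod n, k - 1), m - 1 - c)"
    have dist: "prism_dist p q = n div 2 + (k - 1) + (m - 1)" "prism_dist q p = n div 2 + (k - 1) + (m - 1)"
      using ic by (auto simp: p_def q_def product_dist_def cycle_dist_antipode path_dist_def)
    \<comment> \<open>Each summand is bounded by the diameter of its factor, so the distance between
      \<open>p\<close> and \<open>q\<close> is the largest possible.\<close>
    have le: "prism_dist u v \<le> n div 2 + (k - 1) + (m - 1)"
      if "u \<in> pverts prism" "v \<in> pverts prism" for u v
      unfolding product_dist_def using that
      by (intro add_mono cycle_dist_le) (auto simp: path_dist_def pverts_prism)
    have "p \<in> Q \<or> q \<in> Q"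
    proof (rule strong_resolving_set_diametral_pair[OF pair_graph_prism graph_dist_prism assms(2)])
      show p: "p \<in> pverts prism" and q: "q \<in> pverts prism"
        using ic nkm by (auto simp: p_def q_def pverts_prism)
      show "p \<noteq> q" using nkm by (auto simp: p_def q_def)
      show "prism_dist q r \<le> prism_dist q p" "prism_dist p r \<le> prism_dist p q"
        if "r \<in> pverts prism" for r
        using le p q that unfolding dist by auto
    qed
    then show ?thesis by (auto simp: A_def ic p_def q_def)
  qed
  ultimately have "card ?I \<le> card Q"
    by (rule card_disjoint_family_le[OF assms(1)])
  \<comment> \<open>As \<open>m\<close> is at least 2, the ends 0 and \<open>m - 1\<close>
    differ.\<close>
  moreover have "card ?I = 2 * n"
    using nkm by (simp add: card_cartesian_product)
  ultimately show ?thesis by (simp only:)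
qed

lemma sdim_prism: "sdim prism = 2 * n"
  unfolding sdim_def
proof (rule Least_equality)
  show "\<exists>Q. finite Q \<and> strong_resolving_set prism Q \<and> card Q = 2 * n"
    using nkm prism_strong_resolving_set
    by (intro exI[of _ "({..<n} \<times> {0}) \<times> {0, m - 1}"]) (simp add: card_cartesian_product)
qed (use prism_strong_resolving_set_card_ge in blast)

end

theorem theorem3p12:
  fixes n k m :: nat
  assumes "n \<ge> 3" and "k \<ge> 3" and "m \<ge> 2"
  shows "sdim ((cycle_graph n \<box> path_graph k) \<box> path_graph m) = 2 * n"
  using assms by (intro sdim_prism) simp_all

end
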